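(* Let $q\ge 3$ and $s_1,s_2,s_3\ge 3$ be integers. Then $$R(K_{2s_1-1}^{(3)}-e,\ K_{2s_2-1}^{(3)},\ K_{2s_3-1}^{(3)},\ K_5^{(3)},\ K_{q+1}^{(3)}-e;3)\ >\ q\bigl(R(K_{s_1},K_{s_2},K_{s_3};2)-1\bigr).$$
   Context: $K_m^{(r)}$ denotes the complete $r$-uniform hypergraph on $m$ vertices ($K_m=K_m^{(2)}$), and $K_m^{(3)}-e$ denotes $K_m^{(3)}$ with one hyperedge removed. For $r$-uniform hypergraphs $H_1,\dots,H_t$, the Ramsey number $R(H_1,\dots,H_t;r)$ is the least positive integer $p$ such that every coloring of the hyperedges of $K_p^{(r)}$ with colors $1,\dots,t$ contains, for some $i$, a subhypergraph isomorphic to $H_i$ all of whose hyperedges have color $i$. Here $q$ is just a positive integer (not a field order). *)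

theory Defs
  imports "HOL-Library.Ramsey"
begin

text \<open>A hypergraph is a pair of a vertex set and a set of hyperedges.\<close>

type_synonym 'a hypergraph = "'a set \<times> 'a set set"

abbreviation verts :: "'a hypergraph \<Rightarrow> 'a set" where
  "verts H \<equiv> fst H"

abbreviation hyperedges :: "'a hypergraph \<Rightarrow> 'a set set" where
  "hyperedges H \<equiv> snd H"

definition complete_hg :: "nat \<Rightarrow> nat \<Rightarrow> nat hypergraph" where
  "complete_hg r m = ({..<m}, [{..<m}]\<^bsup>r\<^esup>)"

text \<open>The hyperedge removed is \<open>{..<r}\<close>; by \<open>complete_minus_hg_iso\<close> below, removing any other
  hyperedge gives an isomorphic hypergraph.\<close>

definition complete_minus_hg :: "nat \<Rightarrow> nat \<Rightarrow> nat hypergraph" where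
  "complete_minus_hg r m = ({..<m}, [{..<m}]\<^bsup>r\<^esup> - {{..<r}})"

definition subhypergraph :: "'a hypergraph \<Rightarrow> 'a hypergraph \<Rightarrow> bool" where
  "subhypergraph S H \<longleftrightarrow>
     verts S \<subseteq> verts H \<and> hyperedges S \<subseteq> hyperedges H \<and> (\<forall>e \<in> hyperedges S. e \<subseteq> verts S)"

definition hg_iso :: "'a hypergraph \<Rightarrow> 'b hypergraph \<Rightarrow> bool" where
  "hg_iso G H \<longleftrightarrow>
     (\<exists>f. bij_betw f (verts G) (verts H) \<and> (\<lambda>e. f ` e) ` hyperedges G = hyperedges H)"

text \<open>The hypergraphs \<open>Hs\<close> are indexed from \<open>0\<close>, and so are the colours: \<open>Hs ! i\<close> is to be found
  in colour \<open>i\<close>.\<close>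

definition hg_arrows :: "nat \<Rightarrow> nat \<Rightarrow> 'a hypergraph list \<Rightarrow> bool" where
  "hg_arrows r p Hs \<longleftrightarrow>
     (\<forall>c :: nat set \<Rightarrow> nat. c \<in> hyperedges (complete_hg r p) \<rightarrow> {..<length Hs} \<longrightarrow>
       (\<exists>i < length Hs. \<exists>S. subhypergraph S (complete_hg r p) \<and> hg_iso S (Hs ! i) \<and>
          (\<forall>e \<in> hyperedges S. c e = i)))"

definition ramsey_number :: "nat \<Rightarrow> 'a hypergraph list \<Rightarrow> nat" where
  "ramsey_number r Hs = (LEAST p. 0 < p \<and> hg_arrows r p Hs)"

lemma complete_minus_hg_iso:
  assumes "e \<in> hyperedges (complete_hg r m)"
  shows "hg_iso ({..<m}, hyperedges (complete_hg r m) - {e}) (complete_minus_hg r m)"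
proof -
  have e: "e \<subseteq> {..<m}" "finite e" "card e = r"
    using assms by (auto simp: complete_hg_def nsets_def)
  have rm: "r \<le> m" using card_mono[OF _ e(1)] e(3) by simp
  obtain f where f: "bij_betw f e {..<r}"
    using finite_same_card_bij[of e "{..<r}"] e by auto
  have "card ({..<m} - e) = card ({..<m} - {..<r})"
    using e rm by (simp add: card_Diff_subset)
  then obtain g where g: "bij_betw g ({..<m} - e) ({..<m} - {..<r})"
    using finite_same_card_bij[of "{..<m} - e" "{..<m} - {..<r}"] by auto
  define h where "h x = (if x \<in> e then f x else g x)" for x
  have he: "bij_betw h e {..<r}"
    using f by (rule bij_betw_cong[THEN iffD1, rotated]) (simp add: h_def)
  have hg: "bij_betw h ({..<m} - e) ({..<m} - {..<r})"
    using g by (rule bij_betw_cong[THEN iffD1, rotated]) (simp add: h_def)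
  have h: "bij_betw h {..<m} {..<m}"
  proof -
    have "e \<union> ({..<m} - e) = {..<m}" "{..<r} \<union> ({..<m} - {..<r}) = {..<m}"
      using e(1) rm by auto
    then show ?thesis using bij_betw_combine[OF he hg] by (metis Diff_disjoint)
  qed
  have bij: "bij_betw ((`) h) ([{..<m}]\<^bsup>r\<^esup>) ([{..<m}]\<^bsup>r\<^esup>)"
    using bij_betw_nsets[OF h] .
  have "(`) h ` ([{..<m}]\<^bsup>r\<^esup> - {e}) = [{..<m}]\<^bsup>r\<^esup> - {h ` e}"
    using bij assms unfolding bij_betw_def complete_hg_def
    by (simp add: inj_on_image_set_diff[where C = "[{..<m}]\<^bsup>r\<^esup>"])
  moreover have "h ` e = {..<r}" using he by (simp add: bij_betw_def)
  ultimately show ?thesis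
    using h by (auto simp: hg_iso_def complete_hg_def complete_minus_hg_def)
qed

end

theory Submission imports Defs begin

text \<open>Let \<open>n = R(K\<^sub>s\<^sub>1, K\<^sub>s\<^sub>2, K\<^sub>s\<^sub>3; 2) - 1\<close> and let \<open>\<chi>\<close> colour the edges of \<open>K\<^sub>n\<close> with \<open>0, 1, 2\<close> without
  the forbidden cliques. Blow every vertex up to a fibre of \<open>q\<close> vertices, and colour the pairs of
  the blow-up by \<open>\<chi>\<close> across fibres and by \<open>3\<close> inside a fibre. Colour a triple \<open>4\<close> if it lies in
  a fibre, \<open>j \<in> {1, 2}\<close> if at least two of its pairs have colour \<open>j\<close>, \<open>0\<close> if all its pairs have
  colour \<open>0\<close>, and \<open>3\<close> otherwise.

  A set \<open>V\<close> of \<open>2s - 1\<close> vertices all of whose triples have colour \<open>j \<in> {1, 2}\<close> contains a \<open>\<chi>\<close>-clique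
  on \<open>s\<close> vertices: the pairs not of colour \<open>j\<close> form a matching on \<open>V\<close>, so dropping one end of each
  leaves at least half of \<open>V\<close>. For the colours \<open>0\<close> and \<open>4\<close>, every pair of vertices lies in two triples,
  so the missing hyperedge is harmless. A \<open>K\<^sub>5\<close> in colour \<open>3\<close> would have pair colours such that \<open>0\<close>
  is triangle-free and \<open>1, 2, 3\<close> are matchings; this forces colour \<open>1\<close> to be a perfect matching
  on five points.\<close>

section \<open>Existence of Ramsey numbers; arrowing in terms of vertex sets\<close>

text \<open>The \<open>LEAST\<close> in \<open>ramsey_number\<close> is informative only if some
  \<open>p\<close> qualifies. Ramsey's theorem for complete hypergraphs of the same orders gives a
  monochromatic vertex set, and the target embeds into it.\<close>

lemma hg_arrows_exists:
  assumes "\<And>H. H \<in> set Hs \<Longrightarrow> finite (verts H) \<and> hyperedges H \<subseteq> [verts H]\<^bsup>r\<^esup>"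
  shows "\<exists>p>0. hg_arrows r p Hs"
proof -
  obtain N :: nat where "partn_lst {..<N} (map (\<lambda>H. card (verts H)) Hs) r"
    using ramsey_full by blast
  \<comment> \<open>\<open>Suc N\<close> makes the number of vertices positive.\<close>
  then have N: "partn_lst {..<Suc N} (map (\<lambda>H. card (verts H)) Hs) r"
    by (rule partn_lst_greater_resource) simp
  have "hg_arrows r (Suc N) Hs"
    unfolding hg_arrows_def
  proof (intro allI impI)
    fix c :: "nat set \<Rightarrow> nat"
    assume "c \<in> hyperedges (complete_hg r (Suc N)) \<rightarrow> {..<length Hs}"
    then obtain i U where i: "i < length Hs"
      and U: "U \<in> [{..<Suc N}]\<^bsup>(card (verts (Hs ! i)))\<^esup>" and mono: "c ` [U]\<^bsup>r\<^esup> \<subseteq> {i}"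
      using partn_lstE[OF N, of c "length Hs"] by (auto simp: complete_hg_def)
    have H: "finite (verts (Hs ! i))" "hyperedges (Hs ! i) \<subseteq> [verts (Hs ! i)]\<^bsup>r\<^esup>"
      using assms i by auto
    obtain f where f: "bij_betw f (verts (Hs ! i)) U"
      using U H finite_same_card_bij[of "verts (Hs ! i)" U] by (auto simp: nsets_def)
    \<comment> \<open>\<open>f\<close> maps the target into \<open>U\<close>, while
      \<open>hg_iso S\<close> asks for a map out of \<open>S\<close>.\<close>
    define g where "g = inv_into (verts (Hs ! i)) f"
    define S where "S = (U, (`) f ` hyperedges (Hs ! i))"
    have sub: "hyperedges S \<subseteq> [U]\<^bsup>r\<^esup>"
      using bij_betw_nsets[OF f, of r] H(2) by (auto simp: S_def bij_betw_def)
    have g: "bij_betw g U (verts (Hs ! i))"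
      unfolding g_def using f by (rule bij_betw_inv_into)
    have "g ` f ` e = e" if "e \<in> hyperedges (Hs ! i)" for e
      using that f H(2) unfolding g_def
      by (auto simp: nsets_def bij_betw_def subset_iff intro!: inv_into_image_cancel)
    then have "(\<lambda>e. g ` e) ` hyperedges S = hyperedges (Hs ! i)"
      by (simp add: S_def image_image)
    then have "hg_iso S (Hs ! i)"
      using g by (auto simp: hg_iso_def S_def)
    moreover have "subhypergraph S (complete_hg r (Suc N))"
    proof -
      have "verts S = U" "U \<subseteq> {..<Suc N}" using U by (auto simp: S_def nsets_def)
      moreover from sub have "\<forall>e \<in> hyperedges S. e \<subseteq> U" unfolding nsets_def by blast
      ultimately show ?thesis
        using sub nsets_mono[of U "{..<Suc N}" r]
        unfolding subhypergraph_def complete_hg_def fst_conv snd_conv by blast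
    qed
    moreover have "\<forall>e \<in> hyperedges S. c e = i"
      using sub mono by blast
    ultimately show "\<exists>i<length Hs. \<exists>S. subhypergraph S (complete_hg r (Suc N)) \<and>
        hg_iso S (Hs ! i) \<and> (\<forall>e \<in> hyperedges S. c e = i)"
      using i by blast
  qed
  then show ?thesis by blast
qed

lemma hg_iso_complete:
  assumes "finite V" "card V = m"
  shows "hg_iso (V, [V]\<^bsup>r\<^esup>) (complete_hg r m)"
proof -
  obtain f where f: "bij_betw f V {..<m}"
    using finite_same_card_bij[of V "{..<m}"] assms by auto
  then show ?thesis
    using bij_betw_nsets[OF f, of r] by (auto simp: hg_iso_def complete_hg_def bij_betw_def)
qed

text \<open>A monochromatic clique that is too large could be trimmed to exactly
  \<open>ms ! i\<close> vertices, giving a forbidden copy.\<close>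

lemma not_arrows_completeE:
  assumes "\<not> hg_arrows r n (map (complete_hg r) ms)"
  obtains c where "c \<in> [{..<n}]\<^bsup>r\<^esup> \<rightarrow> {..<length ms}"
    and "\<And>i V. \<lbrakk>i < length ms; V \<subseteq> {..<n}; [V]\<^bsup>r\<^esup> \<subseteq> c -` {i}\<rbrakk> \<Longrightarrow> card V < ms ! i"
proof -
  from assms obtain c where c': "c \<in> hyperedges (complete_hg r n) \<rightarrow> {..<length ms}"
    and no: "\<not> (\<exists>i < length ms. \<exists>S. subhypergraph S (complete_hg r n) \<and>
      hg_iso S (map (complete_hg r) ms ! i) \<and> (\<forall>e \<in> hyperedges S. c e = i))"
    unfolding hg_arrows_def length_map by blast
  from c' have c: "c \<in> [{..<n}]\<^bsup>r\<^esup> \<rightarrow> {..<length ms}"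
    by (simp add: complete_hg_def)
  have "card V < ms ! i"
    if i: "i < length ms" and V: "V \<subseteq> {..<n}" and mono: "[V]\<^bsup>r\<^esup> \<subseteq> c -` {i}" for i V
  proof (rule ccontr)
    assume "\<not> card V < ms ! i"
    then obtain W where W: "W \<subseteq> V" "card W = ms ! i" "finite W"
      using obtain_subset_with_card_n[of "ms ! i" V] by auto
    have "subhypergraph (W, [W]\<^bsup>r\<^esup>) (complete_hg r n)"
      using W V by (auto simp: subhypergraph_def complete_hg_def nsets_def)
    moreover have "\<forall>e \<in> hyperedges (W, [W]\<^bsup>r\<^esup>). c e = i"
      using nsets_mono[OF W(1), of r] mono by auto
    ultimately show False
      using no i hg_iso_complete[OF W(3,2), of r] by (metis nth_map)
  qed
  with c show ?thesis by (rule that)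
qed

text \<open>The vertex set of \<open>S\<close> serves as \<open>V\<close>: taking images under the
  isomorphism is injective on vertex subsets, so hyperedges can be pulled back.\<close>

lemma subhypergraph_iso_completeE:
  assumes "subhypergraph S (complete_hg r p)" "hg_iso S (complete_hg r m)"
  obtains V where "V \<subseteq> {..<p}" "card V = m" "[V]\<^bsup>r\<^esup> \<subseteq> hyperedges S"
proof -
  from assms(2) obtain f where f: "bij_betw f (verts S) {..<m}"
    and im: "(`) f ` hyperedges S = [{..<m}]\<^bsup>r\<^esup>"
    by (auto simp: hg_iso_def complete_hg_def)
  have 1: "verts S \<subseteq> {..<p}"
    using assms(1) by (simp add: subhypergraph_def complete_hg_def)
  have 2: "card (verts S) = m"
    using bij_betw_same_card[OF f] by simp
  have inj: "inj_on ((`) f) (Pow (verts S))"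
    using f by (simp add: bij_betw_def inj_on_image_Pow)
  have 3: "[verts S]\<^bsup>r\<^esup> \<subseteq> hyperedges S"
  proof
    fix X assume X: "X \<in> [verts S]\<^bsup>r\<^esup>"
    then have "f ` X \<in> (`) f ` hyperedges S"
      unfolding im by (rule bij_betw_apply[OF bij_betw_nsets[OF f]])
    moreover have "X \<in> Pow (verts S)" "hyperedges S \<subseteq> Pow (verts S)"
      using X assms(1) by (auto simp: subhypergraph_def nsets_def)
    ultimately show "X \<in> hyperedges S"
      using inj by (simp add: inj_on_image_mem_iff)
  qed
  from 1 2 3 show ?thesis by (rule that)
qed

lemma subhypergraph_iso_complete_minusE:
  assumes "subhypergraph S (complete_hg r p)" "hg_iso S (complete_minus_hg r m)"
  obtains V e where "V \<subseteq> {..<p}" "card V = m" "[V]\<^bsup>r\<^esup> - {e} \<subseteq> hyperedges S"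
proof -
  from assms(2) obtain f where f: "bij_betw f (verts S) {..<m}"
    and im: "(`) f ` hyperedges S = [{..<m}]\<^bsup>r\<^esup> - {{..<r}}"
    by (auto simp: hg_iso_def complete_minus_hg_def)
  have 1: "verts S \<subseteq> {..<p}"
    using assms(1) by (simp add: subhypergraph_def complete_hg_def)
  have 2: "card (verts S) = m"
    using bij_betw_same_card[OF f] by simp
  have inj: "inj_on ((`) f) (Pow (verts S))"
    using f by (simp add: bij_betw_def inj_on_image_Pow)
  \<comment> \<open>The exceptional set is the preimage of the removed hyperedge
    \<open>{..<r}\<close>.\<close>
  have 3: "[verts S]\<^bsup>r\<^esup> - {inv_into (verts S) f ` {..<r}} \<subseteq> hyperedges S"
  proof
    fix X assume X: "X \<in> [verts S]\<^bsup>r\<^esup> - {inv_into (verts S) f ` {..<r}}"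
    then have XP: "X \<subseteq> verts S" by (auto simp: nsets_def)
    have "inv_into (verts S) f ` f ` X = X"
      using f XP by (simp add: bij_betw_def inv_into_image_cancel)
    then have "f ` X \<noteq> {..<r}"
      using X by auto
    moreover have "f ` X \<in> [{..<m}]\<^bsup>r\<^esup>"
      using X bij_betw_apply[OF bij_betw_nsets[OF f, of r]] by blast
    ultimately have "f ` X \<in> (`) f ` hyperedges S"
      unfolding im by simp
    moreover have "X \<in> Pow (verts S)" "hyperedges S \<subseteq> Pow (verts S)"
      using XP assms(1) by (auto simp: subhypergraph_def)
    ultimately show "X \<in> hyperedges S"
      using inj by (simp add: inj_on_image_mem_iff)
  qed
  from 1 2 3 show ?thesis by (rule that)
qed

section \<open>Matchings, and pair colourings on five points\<close>

text \<open>The last hypothesis says that \<open>B\<close> is a matching on \<open>V\<close>. Greedy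
  choice: keeping \<open>x\<close> costs \<open>x\<close> and its partner, at most two vertices for
  each one kept.\<close>

lemma matching_large_independent_set:
  assumes "finite V"
    and "\<And>x y. B x y \<Longrightarrow> B y x"
    and "\<And>x y z. \<lbrakk>x \<in> V; y \<in> V; z \<in> V; x \<noteq> y; y \<noteq> z; x \<noteq> z; B x y\<rbrakk> \<Longrightarrow> \<not> B y z"
  shows "\<exists>W \<subseteq> V. card V \<le> 2 * card W \<and> (\<forall>x\<in>W. \<forall>y\<in>W. x \<noteq> y \<longrightarrow> \<not> B x y)"
  using assms(1,3)
proof (induction "card V" arbitrary: V rule: less_induct)
  case less
  show ?case
  proof (cases "V = {}")
    case True
    then show ?thesis by simp
  next
    case False
    then obtain x where x: "x \<in> V" by blast
    define N where "N = {y \<in> V - {x}. B x y}"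
    define V' where "V' = V - insert x N"
    have "y = z" if "y \<in> N" "z \<in> N" for y z
      using that less.prems(2)[of y x z] x assms(2)[of x y] by (auto simp: N_def)
    moreover have finN: "finite N"
      using less.prems(1) by (simp add: N_def)
    ultimately have N1: "card N \<le> 1"
      by (auto simp: card_le_Suc0_iff_eq)
    have "card V' < card V"
      using x less.prems(1) by (intro psubset_card_mono) (auto simp: V'_def)
    then obtain W where W: "W \<subseteq> V'" "card V' \<le> 2 * card W"
      "\<forall>y\<in>W. \<forall>z\<in>W. y \<noteq> z \<longrightarrow> \<not> B y z"
      using less.hyps[of V'] less.prems unfolding V'_def by (metis DiffD1 finite_Diff)
    have finW: "finite W"
      using W(1) less.prems(1) by (auto simp: V'_def intro: finite_subset)
    have xW: "x \<notin> W" using W(1) by (auto simp: V'_def)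
    have "card V = card V' + card (insert x N)"
      using x card_Int_Diff[OF less.prems(1), of "insert x N"]
      by (simp add: V'_def N_def Int_absorb1 subset_iff)
    also have "card (insert x N) \<le> 2"
      using N1 finN card_insert_le_m1[of 2 N x] by (simp add: card_insert_if)
    finally have "card V \<le> 2 * card (insert x W)"
      using W(2) finW xW by simp
    moreover have "\<not> B x y" "\<not> B y x" if "y \<in> W" for y
      using that W(1) assms(2)[of y x] by (auto simp: V'_def N_def)
    ultimately show ?thesis
      using W x by (intro exI[of _ "insert x W"]) (auto simp: V'_def)
  qed
qed

text \<open>Pairs of colour 3 are twins by \<open>blow\<close>. Of the four pairs at a vertex, at
  most two have colour 0, at most one has colour 2 and none has colour 3, so one has colour 1; five
  is odd.\<close>

lemma no_K5_colouring:
  fixes k :: "'a \<Rightarrow> 'a \<Rightarrow> nat"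
  assumes "card V = 5"
    and sym: "\<And>x y. k x y = k y x"
    and le: "\<And>x y. x \<in> V \<Longrightarrow> y \<in> V \<Longrightarrow> k x y \<le> 3"
    and blow: "\<And>x y z. \<lbrakk>x \<in> V; y \<in> V; k x y = 3\<rbrakk> \<Longrightarrow> k x z = k y z"
    and zero: "\<And>x y z. \<lbrakk>x \<in> V; y \<in> V; z \<in> V; x \<noteq> y; y \<noteq> z; x \<noteq> z; k x y = 0; k y z = 0\<rbrakk>
      \<Longrightarrow> k x z \<noteq> 0"
    and proper: "\<And>x y z. \<lbrakk>x \<in> V; y \<in> V; z \<in> V; x \<noteq> y; y \<noteq> z; x \<noteq> z; k x y \<noteq> 0\<rbrakk>
      \<Longrightarrow> k y z \<noteq> k x y"
  shows False
proof -
  have finV: "finite V" using assms(1) by (metis card.infinite zero_neq_numeral)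
  have fresh: "\<exists>u \<in> V. u \<notin> set xs" if "length xs < 5" for xs
    using that assms(1) card_length[of xs] card_mono[of "set xs" V] by fastforce
  \<comment> \<open>The twins \<open>x\<close> and \<open>y\<close> see \<open>z\<close> in the same
    colour; if nonzero, it would repeat at \<open>z\<close>.\<close>
  have no3_triangle: "k x z = 0 \<and> k y z = 0"
    if "x \<in> V" "y \<in> V" "z \<in> V" "x \<noteq> y" "y \<noteq> z" "x \<noteq> z" "k x y = 3" for x y z
    using blow[OF that(1,2,7), of z] proper[of x z y] that sym[of z y] by metis
  \<comment> \<open>Three nonzero colours would be pairwise distinct, hence 1, 2, 3, and the pair of
    colour 3 forces the other two to be 0.\<close>
  have triangle: "k x y = 0 \<or> k y z = 0 \<or> k x z = 0"
    if "x \<in> V" "y \<in> V" "z \<in> V" "x \<noteq> y" "y \<noteq> z" "x \<noteq> z" for x y z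
  proof (rule ccontr)
    assume nz: "\<not> ?thesis"
    have "k y z \<noteq> k x y" "k x z \<noteq> k x y" "k x z \<noteq> k y z"
      using nz that proper[of x y z] proper[of y x z] proper[of x z y] sym[of y x] sym[of z y]
      by auto
    then have "k x y = 3 \<or> k y z = 3 \<or> k x z = 3"
      using nz le[of x y] le[of y z] le[of x z] that by linarith
    then show False
      using nz that no3_triangle[of x y z] no3_triangle[of y z x] no3_triangle[of x z y]
      by (metis sym)
  qed
  \<comment> \<open>Among three 0-neighbours of \<open>x\<close> some pair has colour 0 by
    \<open>triangle\<close>, closing a 0-triangle with \<open>x\<close>.\<close>
  have zero_deg: False
    if "x \<in> V" "y \<in> V" "z \<in> V" "w \<in> V" "distinct [x, y, z, w]"
      and "k x y = 0" "k x z = 0" "k x w = 0" for x y z w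
    using that triangle[of y z w] zero[of y x z] zero[of y x w] zero[of z x w] sym[of y x] sym[of z x]
    by auto
  \<comment> \<open>One end of a pair of colour 3 would have the three other vertices as
    0-neighbours.\<close>
  have no3: "k x y \<noteq> 3" if xy: "x \<in> V" "y \<in> V" "x \<noteq> y" for x y
  proof
    assume 3: "k x y = 3"
    obtain u where u: "u \<in> V" "u \<notin> set [x, y]" using fresh[of "[x, y]"] by auto
    obtain v where v: "v \<in> V" "v \<notin> set [x, y, u]" using fresh[of "[x, y, u]"] by auto
    obtain w where w: "w \<in> V" "w \<notin> set [x, y, u, v]" using fresh[of "[x, y, u, v]"] by auto
    show False
      using zero_deg[of x u v w] no3_triangle[of x y u] no3_triangle[of x y v]
        no3_triangle[of x y w] xy 3 u v w
      by auto
  qed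
  have ex1: "\<exists>y \<in> V. y \<noteq> x \<and> k x y = 1" if x: "x \<in> V" for x
  proof (rule ccontr)
    assume no1: "\<not> ?thesis"
    define N where "N i = {y \<in> V - {x}. k x y = i}" for i
    have "V - {x} \<subseteq> N 0 \<union> N 2"
    proof
      fix y assume y: "y \<in> V - {x}"
      then have "k x y \<le> 3" "k x y \<noteq> 3" "k x y \<noteq> 1"
        using le[of x y] no3[of x y] no1 x by auto
      then show "y \<in> N 0 \<union> N 2" using y by (auto simp: N_def)
    qed
    then have "card (V - {x}) \<le> card (N 0) + card (N 2)"
      using finV card_mono[of "N 0 \<union> N 2" "V - {x}"] card_Un_le[of "N 0" "N 2"]
      by (simp add: N_def)
    moreover have "card (N 2) \<le> 1"
    proof -
      have "y = z" if "y \<in> N 2" "z \<in> N 2" for y z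
        using that proper[of y x z] x sym[of y x] by (auto simp: N_def)
      moreover have "finite (N 2)" using finV by (simp add: N_def)
      ultimately show ?thesis by (auto simp: card_le_Suc0_iff_eq)
    qed
    moreover have "card (N 0) \<le> 2"
    proof (rule ccontr)
      assume "\<not> card (N 0) \<le> 2"
      then obtain T where "T \<subseteq> N 0" "card T = 3"
        using obtain_subset_with_card_n[of 3 "N 0"] by auto
      then obtain y z w where "{y, z, w} \<subseteq> N 0" "distinct [y, z, w]"
        by (auto simp: card_3_iff)
      then show False using zero_deg[of x y z w] x by (auto simp: N_def)
    qed
    ultimately show False using x assms(1) finV by simp
  qed
  have unique1: "y = z"
    if "x \<in> V" "y \<in> V" "z \<in> V" "x \<noteq> y" "x \<noteq> z" "k x y = 1" "k x z = 1" for x y z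
    using that proper[of y x z] sym[of y x] by auto
  \<comment> \<open>Three disjoint pairs of colour 1 would occupy six vertices.\<close>
  obtain a where a: "a \<in> V" using fresh[of "[]"] by auto
  obtain b where b: "b \<in> V" "b \<noteq> a" "k a b = 1" using ex1[OF a] by auto
  obtain c where c: "c \<in> V" "c \<notin> set [a, b]" using fresh[of "[a, b]"] by auto
  obtain d where d: "d \<in> V" "d \<noteq> c" "k c d = 1" using ex1[OF c(1)] by auto
  have d': "d \<noteq> a" "d \<noteq> b"
    using unique1[of a b c] unique1[of b a c] a b c d sym by auto
  obtain e where e: "e \<in> V" "e \<notin> set [a, b, c, d]" using fresh[of "[a, b, c, d]"] by auto
  obtain f where f: "f \<in> V" "f \<noteq> e" "k e f = 1" using ex1[OF e(1)] by auto
  have "f \<notin> {a, b, c, d}"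
    using unique1[of a b e] unique1[of b a e] unique1[of c d e] unique1[of d c e] a b c d e f sym
    by auto
  then have "card {a, b, c, d, e, f} = 6" using b c d d' e f by auto
  moreover have "{a, b, c, d, e, f} \<subseteq> V" using a b c d e f by auto
  ultimately show False using card_mono[OF finV, of "{a, b, c, d, e, f}"] assms(1) by linarith
qed

section \<open>The blow-up colouring\<close>

text \<open>Two choices of the third vertex give distinct triples, and \<open>e\<close> is at most
  one of them. The orders \<open>q + 1\<close> and \<open>2 * s1 - 1\<close> both reach 4.\<close>

lemma pair_in_triple_avoiding:
  assumes "card V \<ge> 4" "x \<in> V" "y \<in> V" "x \<noteq> y"
  obtains z where "z \<in> V" "z \<noteq> x" "z \<noteq> y" "{x, y, z} \<in> [V]\<^bsup>3\<^esup> - {e}"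
proof -
  have "finite V" using assms(1) card.infinite by fastforce
  then have "card (V - {x, y}) \<ge> 2" using assms by simp
  then obtain T where T: "T \<subseteq> V - {x, y}" "card T = 2"
    using obtain_subset_with_card_n by metis
  then obtain z w where "T = {z, w}" "z \<noteq> w"
    by (auto simp: card_2_iff)
  with T have zw: "z \<in> V - {x, y}" "w \<in> V - {x, y}" "z \<noteq> w"
    by auto
  then have "{x, y, z} \<noteq> {x, y, w}" by auto
  then have "{x, y, z} \<noteq> e \<or> {x, y, w} \<noteq> e" by auto
  moreover have "{x, y, z} \<in> [V]\<^bsup>3\<^esup>" "{x, y, w} \<in> [V]\<^bsup>3\<^esup>"
    using zw assms by (auto simp: nsets_def)
  ultimately show ?thesis using that[of z] that[of w] zw by auto
qed

text \<open>Allowing \<open>p \<le> q * n\<close> rather than equality lets this apply to the Ramsey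
  number itself, without monotonicity of \<open>hg_arrows\<close>.\<close>

lemma blowup_not_arrows:
  fixes q n p s1 s2 s3 :: nat and \<chi> :: "nat set \<Rightarrow> nat"
  assumes "q \<ge> 3" "s1 \<ge> 3" "p \<le> q * n"
    and chi: "\<chi> \<in> [{..<n}]\<^bsup>2\<^esup> \<rightarrow> {..<3}"
    and noclique: "\<And>i V. \<lbrakk>i < 3; V \<subseteq> {..<n}; [V]\<^bsup>2\<^esup> \<subseteq> \<chi> -` {i}\<rbrakk> \<Longrightarrow> card V < [s1, s2, s3] ! i"
  shows "\<not> hg_arrows 3 p
           [complete_minus_hg 3 (2 * s1 - 1), complete_hg 3 (2 * s2 - 1),
            complete_hg 3 (2 * s3 - 1), complete_hg 3 5, complete_minus_hg 3 (q + 1)]"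
    (is "\<not> hg_arrows 3 p ?Hs")
proof
  assume arrows: "hg_arrows 3 p ?Hs"
  define g where "g v = v div q" for v :: nat
  \<comment> \<open>The diagonal also gets 3, so two vertices of one fibre agree in \<open>k\<close>
    towards every vertex, themselves included.\<close>
  define k where "k x y = (if g x = g y then 3 else \<chi> {g x, g y})" for x y
  \<comment> \<open>Two pairs of a triple always share a vertex, here \<open>y\<close>.\<close>
  define maj where "maj j e \<longleftrightarrow>
    (\<exists>x y z. e = {x, y, z} \<and> x \<noteq> y \<and> y \<noteq> z \<and> x \<noteq> z \<and> k x y = j \<and> k y z = j)" for j e
  define fibre where "fibre e \<longleftrightarrow> (\<forall>x\<in>e. \<forall>y\<in>e. g x = g y)" for e
  define zero where "zero e \<longleftrightarrow> (\<forall>x\<in>e. \<forall>y\<in>e. x \<noteq> y \<longrightarrow> k x y = 0)" for e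
  \<comment> \<open>On triples below \<open>p\<close> the tests exclude each other. Those left for
    colour 3 have pair colours 0, 1, 2, or two 0s and one nonzero colour.\<close>
  define c where "c e = (if fibre e then 4 else if maj 1 e then 1 else if maj 2 e then 2
    else if zero e then 0 else (3::nat))" for e
  have c_cases: "fibre e \<and> c e = 4 \<or> maj 1 e \<and> c e = 1 \<or> maj 2 e \<and> c e = 2 \<or> zero e \<and> c e = 0
    \<or> \<not> fibre e \<and> \<not> maj 1 e \<and> \<not> maj 2 e \<and> \<not> zero e \<and> c e = 3" for e
    unfolding c_def by simp
  have c0D: "zero e" if "c e = 0" for e
    using that c_cases[of e] by - (elim disjE conjE; (assumption | linarith))
  have c1D: "maj 1 e" if "c e = 1" for e
    using that c_cases[of e] by - (elim disjE conjE; (assumption | linarith))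
  have c2D: "maj 2 e" if "c e = 2" for e
    using that c_cases[of e] by - (elim disjE conjE; (assumption | linarith))
  have c3D: "\<not> fibre e" "\<not> maj 1 e" "\<not> maj 2 e" "\<not> zero e" if "c e = 3" for e
    using that c_cases[of e] by - (elim disjE conjE; (assumption | linarith))+
  have c4D: "fibre e" if "c e = 4" for e
    using that c_cases[of e] by - (elim disjE conjE; (assumption | linarith))
  have sym: "k x y = k y x" for x y
    by (simp add: k_def insert_commute)
  have g_less: "g v < n" if "v < p" for v
    using that assms(1,3) by (auto simp: g_def less_mult_imp_div_less mult.commute)
  have k_le: "k x y \<le> 3" if "x < p" "y < p" for x y
  proof (cases "g x = g y")
    case False
    then have "{g x, g y} \<in> [{..<n}]\<^bsup>2\<^esup>" using g_less that by simp
    then show ?thesis using chi by (auto simp: k_def Pi_iff less_imp_le)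
  qed (simp add: k_def)
  have k3: "g x = g y" if "k x y = 3" "x < p" "y < p" for x y
  proof (rule ccontr)
    assume neq: "g x \<noteq> g y"
    then have "{g x, g y} \<in> [{..<n}]\<^bsup>2\<^esup>" using g_less that by simp
    then have "\<chi> {g x, g y} < 3" using chi by auto
    then show False using neq that(1) by (simp add: k_def)
  qed
  \<comment> \<open>Pairs inside a fibre have colour 3, so \<open>W\<close> meets each fibre at most
    once and projects injectively to a clique of \<open>\<chi>\<close>.\<close>
  have clique: "card W < [s1, s2, s3] ! j"
    if W: "W \<subseteq> {..<p}" and j: "j < 3"
      and mono: "\<And>x y. \<lbrakk>x \<in> W; y \<in> W; x \<noteq> y\<rbrakk> \<Longrightarrow> k x y = j" for W j
  proof -
    have "inj_on g W"
    proof (rule inj_onI, rule ccontr)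
      fix x y assume "x \<in> W" "y \<in> W" "g x = g y" "x \<noteq> y"
      then show False using mono[of x y] j by (simp add: k_def)
    qed
    moreover have "[g ` W]\<^bsup>2\<^esup> \<subseteq> \<chi> -` {j}"
    proof
      fix f assume "f \<in> [g ` W]\<^bsup>2\<^esup>"
      then obtain x y where xy: "x \<in> W" "y \<in> W" "g x \<noteq> g y" "f = {g x, g y}"
        by (auto elim!: nsets2_E)
      then have "x \<noteq> y" by auto
      with xy mono[of x y] show "f \<in> \<chi> -` {j}" by (simp add: k_def)
    qed
    moreover have "g ` W \<subseteq> {..<n}" using W g_less by auto
    ultimately show ?thesis using noclique[of j "g ` W"] j by (simp add: card_image)
  qed
  have maj_clique: False
    if V: "V \<subseteq> {..<p}" "card V = 2 * ([s1, s2, s3] ! j) - 1" and j: "j < 3"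
      and maj: "\<And>e. e \<in> [V]\<^bsup>3\<^esup> \<Longrightarrow> maj j e" for V j
  proof -
    \<comment> \<open>Two pairs at \<open>y\<close> off colour \<open>j\<close> would leave only one
      pair of the triple in colour \<open>j\<close>.\<close>
    have match: "\<not> k y z \<noteq> j"
      if "x \<in> V" "y \<in> V" "z \<in> V" "x \<noteq> y" "y \<noteq> z" "x \<noteq> z" "k x y \<noteq> j" for x y z
    proof -
      have "maj j {x, y, z}" using that by (intro maj) (auto simp: nsets_def)
      then obtain x' y' z' where *: "{x, y, z} = {x', y', z'}" "x' \<noteq> y'" "y' \<noteq> z'" "x' \<noteq> z'"
        "k x' y' = j" "k y' z' = j"
        unfolding maj_def by auto
      then have "x' \<in> {x, y, z}" "y' \<in> {x, y, z}" "z' \<in> {x, y, z}" by auto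
      then show ?thesis using * that(4-7) sym by (elim insertE emptyE) auto
    qed
    obtain W where W: "W \<subseteq> V" "card V \<le> 2 * card W" "\<forall>x\<in>W. \<forall>y\<in>W. x \<noteq> y \<longrightarrow> \<not> k x y \<noteq> j"
      using matching_large_independent_set[of V "\<lambda>x y. k x y \<noteq> j"] match sym V(1) finite_subset
      by (metis finite_lessThan)
    have "card W < [s1, s2, s3] ! j"
      using W V(1) j by (intro clique) auto
    \<comment> \<open>An integer that is at least half of \<open>2 * s - 1\<close> is at least
      \<open>s\<close>.\<close>
    with W(2) V(2) show False by linarith
  qed
  have "c \<in> hyperedges (complete_hg 3 p) \<rightarrow> {..<length ?Hs}"
    by (auto simp: c_def)
  then obtain i S where i: "i < length ?Hs" and S: "subhypergraph S (complete_hg 3 p)"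
    and iso: "hg_iso S (?Hs ! i)" and mono: "\<And>e. e \<in> hyperedges S \<Longrightarrow> c e = i"
    using arrows unfolding hg_arrows_def by blast
  consider "i = 0" | "i = 1" | "i = 2" | "i = 3" | "i = 4"
    using i by fastforce
  then show False
  proof cases
    case 1
    then obtain V e where V: "V \<subseteq> {..<p}" "card V = 2 * s1 - 1" "[V]\<^bsup>3\<^esup> - {e} \<subseteq> hyperedges S"
      using subhypergraph_iso_complete_minusE[OF S] iso by auto
    have "k x y = 0" if xy: "x \<in> V" "y \<in> V" "x \<noteq> y" for x y
    proof -
      have "4 \<le> card V" using V(2) assms(2) by linarith
      then obtain z where "{x, y, z} \<in> [V]\<^bsup>3\<^esup> - {e}"
        using xy by (rule pair_in_triple_avoiding)
      then have "c {x, y, z} = 0" using V(3) mono 1 by auto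
      then show ?thesis using c0D xy(3) unfolding zero_def by blast
    qed
    then have "card V < s1" using clique[of V 0] V(1) by simp
    then show False using V(2) assms(2) by linarith
  next
    case 2
    then obtain V where V: "V \<subseteq> {..<p}" "card V = 2 * s2 - 1" "[V]\<^bsup>3\<^esup> \<subseteq> hyperedges S"
      using subhypergraph_iso_completeE[OF S] iso by auto
    have "maj 1 e" if "e \<in> [V]\<^bsup>3\<^esup>" for e
      using mono[of e] V(3) that 2 by (intro c1D) auto
    then show False using maj_clique[of V 1] V by simp
  next
    case 3
    then obtain V where V: "V \<subseteq> {..<p}" "card V = 2 * s3 - 1" "[V]\<^bsup>3\<^esup> \<subseteq> hyperedges S"
      using subhypergraph_iso_completeE[OF S] iso by auto
    have "maj 2 e" if "e \<in> [V]\<^bsup>3\<^esup>" for e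
      using mono[of e] V(3) that 3 by (intro c2D) auto
    then show False using maj_clique[of V 2] V by simp
  next
    case 4
    then obtain V where V: "V \<subseteq> {..<p}" "card V = 5" "[V]\<^bsup>3\<^esup> \<subseteq> hyperedges S"
      using subhypergraph_iso_completeE[OF S] iso by (auto simp: numeral_eq_Suc)
    have c3: "c {x, y, z} = 3" if "x \<in> V" "y \<in> V" "z \<in> V" "x \<noteq> y" "y \<noteq> z" "x \<noteq> z" for x y z
    proof -
      have "{x, y, z} \<in> [V]\<^bsup>3\<^esup>" using that by (auto simp: nsets_def)
      then show ?thesis using mono V(3) 4 by blast
    qed
    show False
    proof (rule no_K5_colouring[of V k])
      show "card V = 5" by fact
      show "k x y = k y x" for x y by (rule sym)
      show "k x y \<le> 3" if "x \<in> V" "y \<in> V" for x y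
        using k_le V(1) that by blast
      show "k x z = k y z" if "x \<in> V" "y \<in> V" "k x y = 3" for x y z
      proof -
        have "g x = g y" using k3[OF that(3)] V(1) that(1,2) by blast
        then show ?thesis by (simp only: k_def)
      qed
      show "k x z \<noteq> 0"
        if xyz: "x \<in> V" "y \<in> V" "z \<in> V" "x \<noteq> y" "y \<noteq> z" "x \<noteq> z" "k x y = 0" "k y z = 0"
        for x y z
      proof
        assume "k x z = 0"
        then have "zero {x, y, z}"
          using xyz(7,8) sym unfolding zero_def by auto
        then show False using c3D[OF c3[OF xyz(1-6)]] by blast
      qed
      show "k y z \<noteq> k x y"
        if xyz: "x \<in> V" "y \<in> V" "z \<in> V" "x \<noteq> y" "y \<noteq> z" "x \<noteq> z" "k x y \<noteq> 0" for x y z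
      proof
        assume eq: "k y z = k x y"
        \<comment> \<open>A nonzero colour repeated at \<open>y\<close> gives the triple colour 1 or
          2, or, if it is 3, puts the triple in one fibre.\<close>
        then have "maj (k x y) {x, y, z}" using xyz(4-6) unfolding maj_def by blast
        then have "k x y \<noteq> 1" "k x y \<noteq> 2"
          using c3D[OF c3[OF xyz(1-6)]] by auto
        then have "k x y = 3" using k_le[of x y] xyz V(1) by force
        then have "g x = g y" "g y = g z" using k3[of x y] k3[of y z] eq xyz V(1) by auto
        then have "fibre {x, y, z}" by (simp add: fibre_def)
        then show False using c3D[OF c3[OF xyz(1-6)]] by blast
      qed
    qed
  next
    case 5
    then obtain V e where V: "V \<subseteq> {..<p}" "card V = q + 1" "[V]\<^bsup>3\<^esup> - {e} \<subseteq> hyperedges S"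
      using subhypergraph_iso_complete_minusE[OF S] iso by (auto simp: numeral_eq_Suc)
    have same: "g x = g y" if xy: "x \<in> V" "y \<in> V" "x \<noteq> y" for x y
    proof -
      have "4 \<le> card V" using V(2) assms(1) by linarith
      then obtain z where "{x, y, z} \<in> [V]\<^bsup>3\<^esup> - {e}"
        using xy by (rule pair_in_triple_avoiding)
      then have "c {x, y, z} = 4" using V(3) mono 5 by auto
      then show ?thesis using c4D unfolding fibre_def by blast
    qed
    obtain v where v: "v \<in> V" using V(2) by fastforce
    \<comment> \<open>The fibre of \<open>v\<close> is an interval of \<open>q\<close> numbers, too
      small for \<open>q + 1\<close> vertices.\<close>
    have "V \<subseteq> {g v * q ..< g v * q + q}"
    proof
      fix x assume "x \<in> V"
      then have "x div q = g v" using same[OF _ v, of x] by (cases "x = v") (auto simp: g_def)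
      then have "g v * q + x mod q = x" using div_mult_mod_eq[of x q] by simp
      moreover have "x mod q < q" using assms(1) by simp
      ultimately show "x \<in> {g v * q ..< g v * q + q}"
        unfolding atLeastLessThan_iff by linarith
    qed
    then have "card V \<le> q" using card_mono[of "{g v * q ..< g v * q + q}" V] by simp
    then show False using V(2) by simp
  qed
qed

section \<open>From the blow-up to the Ramsey numbers\<close>

theorem theorem13:
  fixes q s1 s2 s3 :: nat
  assumes "q \<ge> 3" and "s1 \<ge> 3" and "s2 \<ge> 3" and "s3 \<ge> 3"
  shows "ramsey_number 3
           [complete_minus_hg 3 (2 * s1 - 1), complete_hg 3 (2 * s2 - 1),
            complete_hg 3 (2 * s3 - 1), complete_hg 3 5, complete_minus_hg 3 (q + 1)]
         > q * (ramsey_number 2 [complete_hg 2 s1, complete_hg 2 s2, complete_hg 2 s3] - 1)"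
proof -
  let ?Hs = "[complete_minus_hg 3 (2 * s1 - 1), complete_hg 3 (2 * s2 - 1),
            complete_hg 3 (2 * s3 - 1), complete_hg 3 5, complete_minus_hg 3 (q + 1)]"
  let ?R = "ramsey_number 2 [complete_hg 2 s1, complete_hg 2 s2, complete_hg 2 s3]"
  define p where "p = ramsey_number 3 ?Hs"
  have "\<exists>p>0. hg_arrows 3 p ?Hs"
    by (rule hg_arrows_exists) (auto simp: complete_hg_def complete_minus_hg_def)
  then have p: "0 < p" "hg_arrows 3 p ?Hs"
    using LeastI_ex[of "\<lambda>p. 0 < p \<and> hg_arrows 3 p ?Hs"]
    unfolding p_def ramsey_number_def by blast+
  have "q * (?R - 1) < p"
  proof (rule ccontr)
    assume "\<not> q * (?R - 1) < p"
    then have le: "p \<le> q * (?R - 1)" by simp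
    \<comment> \<open>Minimality of \<open>?R\<close> rules out arrowing at \<open>?R - 1\<close>
      only if \<open>?R - 1\<close> is positive; otherwise \<open>p\<close> would be 0.\<close>
    then have "0 < ?R - 1" using p(1) by (cases "?R - 1 = 0") auto
    then have "\<not> hg_arrows 2 (?R - 1) [complete_hg 2 s1, complete_hg 2 s2, complete_hg 2 s3]"
      using not_less_Least[of "?R - 1"
          "\<lambda>p. 0 < p \<and> hg_arrows 2 p [complete_hg 2 s1, complete_hg 2 s2, complete_hg 2 s3]"]
      unfolding ramsey_number_def by auto
    then have "\<not> hg_arrows 2 (?R - 1) (map (complete_hg 2) [s1, s2, s3])" by simp
    then obtain \<chi> where chi: "\<chi> \<in> [{..<?R - 1}]\<^bsup>2\<^esup> \<rightarrow> {..<length [s1, s2, s3]}"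
      and noclique: "\<And>i V. \<lbrakk>i < length [s1, s2, s3]; V \<subseteq> {..<?R - 1}; [V]\<^bsup>2\<^esup> \<subseteq> \<chi> -` {i}\<rbrakk>
        \<Longrightarrow> card V < [s1, s2, s3] ! i"
      by (rule not_arrows_completeE) blast
    have "length [s1, s2, s3] = 3" by simp
    from blowup_not_arrows[OF assms(1,2) le chi[unfolded this] noclique[unfolded this]] p(2)
    show False by blast
  qed
  then show ?thesis by (simp only: p_def)
qed

end
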